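(* For $n\ge 1$ let $D_n$ be the disjointness graph: its vertices are the non-empty proper subsets of $\{1,\dots,n\}$, and two subsets are adjacent if and only if they are disjoint. For $n\in\{1,2\}$ we have $\mathrm{box}(D_n)=\dim_{TH}(D_n)=0$. For $n\ge 3$ we have $\mathrm{box}(D_n)=\dim_{TH}(D_n)=n-1$.
   Context: All graphs are finite and simple. The boxicity $\mathrm{box}(G)$ of a graph $G$ is the minimum integer $d\ge 0$ such that there exist $d$ interval graphs $I_1,\dots,I_d$ on the vertex set $V(G)$ with $E(G)=\bigcap_{j=1}^d E(I_j)$. For a finite set $V$, $\alpha\colon V\to\mathbb{R}$ and $S\in\mathbb{R}$, the threshold graph $T(\alpha,S)$ has vertex set $V$ and edges all $\{v,w\}$, $v\neq w$, with $\alpha(v)+\alpha(w)\ge S$; a graph is a threshold graph if it is of this form. The threshold dimension $\dim_{TH}(G)$ is the minimum $d\ge 0$ such that there exist $d$ threshold graphs $H_1,\dots,H_d$ on $V(G)$ with $E(G)=\bigcap_{j=1}^d E(H_j)$. In both definitions the empty intersection ($d=0$) is the set of all pairs of vertices, so the parameter is $0$ exactly for complete graphs (including the graph with no vertices). *)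

theory Defs
  imports Complex_Main
begin

type_synonym 'a sgraph = "'a set \<times> 'a set set"

abbreviation verts :: "'a sgraph \<Rightarrow> 'a set" where
  "verts \<equiv> fst"

abbreviation edges :: "'a sgraph \<Rightarrow> 'a set set" where
  "edges \<equiv> snd"

definition all_pairs :: "'a set \<Rightarrow> 'a set set" where
  "all_pairs V = {{v, w} | v w. v \<in> V \<and> w \<in> V \<and> v \<noteq> w}"

definition simple_graph :: "'a sgraph \<Rightarrow> bool" where
  "simple_graph G \<longleftrightarrow> finite (verts G) \<and> edges G \<subseteq> all_pairs (verts G)"

text \<open>The relation \<open>R\<close> below is only ever instantiated with symmetric relations.\<close>

definition graph_of :: "'a set \<Rightarrow> ('a \<Rightarrow> 'a \<Rightarrow> bool) \<Rightarrow> 'a sgraph" where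
  "graph_of V R = (V, {{v, w} | v w. v \<in> V \<and> w \<in> V \<and> v \<noteq> w \<and> R v w})"

definition interval_graph :: "'a sgraph \<Rightarrow> bool" where
  "interval_graph G \<longleftrightarrow> finite (verts G) \<and>
     (\<exists>l r :: 'a \<Rightarrow> real. (\<forall>v \<in> verts G. l v \<le> r v) \<and>
        G = graph_of (verts G) (\<lambda>v w. {l v..r v} \<inter> {l w..r w} \<noteq> {}))"

definition threshold_graph_on :: "'a set \<Rightarrow> ('a \<Rightarrow> real) \<Rightarrow> real \<Rightarrow> 'a sgraph" where
  "threshold_graph_on V \<alpha> S = graph_of V (\<lambda>v w. \<alpha> v + \<alpha> w \<ge> S)"

definition threshold_graph :: "'a sgraph \<Rightarrow> bool" where
  "threshold_graph G \<longleftrightarrow> finite (verts G) \<and>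
     (\<exists>\<alpha> S. G = threshold_graph_on (verts G) \<alpha> S)"

text \<open>Intersecting with \<^term>\<open>all_pairs (verts G)\<close> matters only for \<open>d = 0\<close>, where it
  makes the empty intersection the set of all pairs of vertices.\<close>

definition intersection_of :: "('a sgraph \<Rightarrow> bool) \<Rightarrow> nat \<Rightarrow> 'a sgraph \<Rightarrow> bool" where
  "intersection_of P d G \<longleftrightarrow>
     (\<exists>H :: nat \<Rightarrow> 'a sgraph. (\<forall>j<d. P (H j) \<and> verts (H j) = verts G) \<and>
        edges G = all_pairs (verts G) \<inter> (\<Inter>j<d. edges (H j)))"

definition boxicity :: "'a sgraph \<Rightarrow> nat" where
  "boxicity G = (LEAST d. intersection_of interval_graph d G)"

definition threshold_dim :: "'a sgraph \<Rightarrow> nat" where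
  "threshold_dim G = (LEAST d. intersection_of threshold_graph d G)"

definition disjointness_graph :: "nat \<Rightarrow> nat set sgraph" where
  "disjointness_graph n =
     graph_of {A. A \<subseteq> {1..n} \<and> A \<noteq> {} \<and> A \<noteq> {1..n}} (\<lambda>A B. A \<inter> B = {})"

lemma simple_graph_disjointness_graph: "simple_graph (disjointness_graph n)"
proof -
  have "finite {A. A \<subseteq> {1..n} \<and> A \<noteq> {} \<and> A \<noteq> {1..n}}"
    by (rule finite_subset[of _ "Pow {1..n}"]) auto
  then show ?thesis
    unfolding simple_graph_def disjointness_graph_def graph_of_def all_pairs_def by auto
qed

text \<open>The minima in \<^const>\<open>boxicity\<close> and \<^const>\<open>threshold_dim\<close> exist for every finite
  simple graph: a complete graph minus one edge is both an interval and a threshold graph.\<close>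

lemma intersection_of_exists:
  assumes G: "simple_graph G"
    and P: "\<And>x y. \<lbrakk>x \<in> verts G; y \<in> verts G; x \<noteq> y\<rbrakk> \<Longrightarrow>
      P (graph_of (verts G) (\<lambda>v w. {v, w} \<noteq> {x, y}))"
  shows "\<exists>d. intersection_of P d G"
proof -
  let ?N = "all_pairs (verts G) - edges G"
  let ?H = "\<lambda>e. graph_of (verts G) (\<lambda>v w. {v, w} \<noteq> e)"
  have "all_pairs (verts G) \<subseteq> Pow (verts G)" by (auto simp: all_pairs_def)
  then have "finite ?N"
    using G unfolding simple_graph_def by (meson finite_Diff finite_Pow_iff finite_subset)
  then obtain f :: "nat \<Rightarrow> 'a set" and d where f: "?N = f ` {i. i < d}"
    unfolding finite_conv_nat_seg_image by blast
  have PH: "P (?H (f j)) \<and> verts (?H (f j)) = verts G" if "j < d" for j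
  proof -
    have "f j \<in> ?N" using f that by blast
    then obtain x y where "f j = {x, y}" "x \<in> verts G" "y \<in> verts G" "x \<noteq> y"
      by (auto simp: all_pairs_def)
    then show ?thesis using P[of x y] by (simp add: graph_of_def)
  qed
  have H: "edges (?H e) = all_pairs (verts G) - {e}" for e
    by (auto simp: graph_of_def all_pairs_def)
  have "edges G = all_pairs (verts G) \<inter> (\<Inter>j<d. edges (?H (f j)))"
  proof -
    have "edges G = all_pairs (verts G) - ?N" using G by (auto simp: simple_graph_def)
    also have "\<dots> = all_pairs (verts G) \<inter> (\<Inter>j<d. edges (?H (f j)))"
      unfolding f H by auto
    finally show ?thesis .
  qed
  then show ?thesis
    unfolding intersection_of_def using PH by (intro exI[of _ d] exI[of _ "\<lambda>j. ?H (f j)"]) auto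
qed

lemma boxicity_attained:
  assumes G: "simple_graph G"
  shows "intersection_of interval_graph (boxicity G) G"
proof -
  have "\<exists>d. intersection_of interval_graph d G"
  proof (rule intersection_of_exists[OF G])
    fix x y assume xy: "x \<in> verts G" "y \<in> verts G" "x \<noteq> y"
    let ?l = "\<lambda>v. if v = y then 2 else (0::real)"
    let ?r = "\<lambda>v. if v = x then 1 else (3::real)"
    have "({v, w} \<noteq> {x, y}) = ({?l v..?r v} \<inter> {?l w..?r w} \<noteq> {})" if "v \<noteq> w" for v w
      using xy that by (auto simp: doubleton_eq_iff)
    then have "graph_of (verts G) (\<lambda>v w. {v, w} \<noteq> {x, y}) =
        graph_of (verts G) (\<lambda>v w. {?l v..?r v} \<inter> {?l w..?r w} \<noteq> {})"
      unfolding graph_of_def by (metis (no_types, lifting))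
    moreover have "\<forall>v. ?l v \<le> ?r v" using xy by auto
    moreover have "verts (graph_of (verts G) R) = verts G" for R by (simp add: graph_of_def)
    moreover have "finite (verts G)" using G by (simp add: simple_graph_def)
    ultimately show "interval_graph (graph_of (verts G) (\<lambda>v w. {v, w} \<noteq> {x, y}))"
      unfolding interval_graph_def by (intro conjI exI[of _ ?l] exI[of _ ?r]) simp_all
  qed
  then show ?thesis unfolding boxicity_def by (rule LeastI_ex)
qed

lemma threshold_dim_attained:
  assumes G: "simple_graph G"
  shows "intersection_of threshold_graph (threshold_dim G) G"
proof -
  have "\<exists>d. intersection_of threshold_graph d G"
  proof (rule intersection_of_exists[OF G])
    fix x y assume xy: "x \<in> verts G" "y \<in> verts G" "x \<noteq> y"
    let ?a = "\<lambda>v. if v = x \<or> v = y then 0 else (1::real)"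
    have "({v, w} \<noteq> {x, y}) = (?a v + ?a w \<ge> 1)" if "v \<noteq> w" for v w
      using xy that by (auto simp: doubleton_eq_iff)
    then have "graph_of (verts G) (\<lambda>v w. {v, w} \<noteq> {x, y}) =
        threshold_graph_on (verts G) ?a 1"
      unfolding graph_of_def threshold_graph_on_def by (metis (no_types, lifting))
    moreover have "verts (graph_of (verts G) R) = verts G" for R by (simp add: graph_of_def)
    moreover have "finite (verts G)" using G by (simp add: simple_graph_def)
    ultimately show "threshold_graph (graph_of (verts G) (\<lambda>v w. {v, w} \<noteq> {x, y}))"
      unfolding threshold_graph_def by (metis (no_types, lifting))
  qed
  then show ?thesis unfolding threshold_dim_def by (rule LeastI_ex)
qed

end

theory Submission
  imports Defs
begin

text \<open>For the upper bound, give \<open>j\<close> weight \<open>2\<close> and \<open>n\<close> weight \<open>1\<close>, for each \<open>j < n\<close>, and make two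
  sets adjacent when their total weight is at most \<open>3\<close>.

  For the lower bound, count the ordered pairs \<open>(k, m)\<close> with \<open>k \<noteq> m\<close>. As \<open>{k}\<close> and \<open>{k, m}\<close>
  are not adjacent, their intervals are disjoint in one of the interval graphs. Within a single
  interval graph, the singletons form a clique, so the sets \<open>{k, m}\<close> that lie to the left of
  \<open>{k}\<close> all contain the element \<open>a\<close> whose interval starts last, those to the right all
  contain some \<open>b\<close>, and each left one meets each right one. Hence an interval graph
  accounts for at most \<open>max (n + 1) 5\<close> of the \<open>n (n - 1)\<close> ordered pairs, and \<open>n - 2\<close>
  interval graphs do not suffice.\<close>

section \<open>Edges of graphs given by a relation\<close>

lemma edge_graph_of_iff:
  assumes "\<And>v w. R v w \<longleftrightarrow> R w v"
  shows "{v, w} \<in> edges (graph_of V R) \<longleftrightarrow> v \<in> V \<and> w \<in> V \<and> v \<noteq> w \<and> R v w"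
  using assms by (auto simp: graph_of_def doubleton_eq_iff)

lemma verts_graph_of [simp]: "verts (graph_of V R) = V"
  by (simp add: graph_of_def)

lemma graph_of_cong:
  assumes "\<And>v w. v \<in> V \<Longrightarrow> w \<in> V \<Longrightarrow> v \<noteq> w \<Longrightarrow> R v w \<longleftrightarrow> R' v w"
  shows "graph_of V R = graph_of V R'"
  using assms unfolding graph_of_def by (simp, blast)

section \<open>Threshold graphs are interval graphs\<close>

lemma finite_positive_lower_bound:
  fixes D :: "real set"
  assumes "finite D" "\<And>x. x \<in> D \<Longrightarrow> x > 0"
  obtains \<delta> where "\<delta> > 0" "\<And>x. x \<in> D \<Longrightarrow> \<delta> < x"
proof -
  have "\<exists>\<delta>>0. \<forall>x\<in>D. \<delta> < x"
    using assms
  proof (induction D)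
    case empty
    then show ?case by (auto intro: exI[of _ 1])
  next
    case (insert y D)
    then obtain \<delta> where "\<delta> > 0" "\<forall>x\<in>D. \<delta> < x" by auto
    then show ?case using insert.prems[of y] by (intro exI[of _ "min \<delta> (y / 2)"]) auto
  qed
  then show ?thesis using that by blast
qed

text \<open>Vertices of weight below \<open>S / 2\<close> become distinct points near \<open>- \<alpha> v\<close>; the others
  become intervals that start at \<open>- S / 2\<close> and reach just beyond \<open>\<alpha> v - S\<close>.\<close>

lemma threshold_imp_interval:
  assumes "threshold_graph G"
  shows "interval_graph G"
proof -
  obtain \<alpha> S where fin: "finite (verts G)" and G: "G = threshold_graph_on (verts G) \<alpha> S"
    using assms by (auto simp: threshold_graph_def)
  define V where "V = verts G"
  have finV: "finite V" using fin by (simp add: V_def)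
  \<comment> \<open>With \<open>\<delta>\<close> below all these gaps, shifts totalling less than
    \<open>\<delta>\<close> neither create an edge nor make points of different weight
    coincide.\<close>
  define D where "D = {0<..} \<inter>
    ((\<lambda>(v, w). S - \<alpha> v - \<alpha> w) ` (V \<times> V) \<union> (\<lambda>(v, w). \<alpha> v - \<alpha> w) ` (V \<times> V))"
  have "finite D" unfolding D_def using finV by blast
  then obtain \<delta> where \<delta>: "\<delta> > 0" "\<And>x. x \<in> D \<Longrightarrow> \<delta> < x"
    using finite_positive_lower_bound[of D] by (metis D_def IntD1 greaterThan_iff)
  have gapS: "\<delta> < S - \<alpha> v - \<alpha> w" if "v \<in> V" "w \<in> V" "\<alpha> v + \<alpha> w < S" for v w
    using that by (intro \<delta>(2)) (force simp: D_def)
  have gap: "\<delta> < \<alpha> v - \<alpha> w" if "v \<in> V" "w \<in> V" "\<alpha> w < \<alpha> v" for v w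
    using that by (intro \<delta>(2)) (force simp: D_def)
  obtain f :: "'a \<Rightarrow> nat" where f: "inj_on f V"
    using finite_imp_inj_to_nat_seg[OF finV] by blast
  define g where "g v = (\<delta> / 2) / (real (f v) + 2)" for v
  have g: "0 < g v" "g v < \<delta> / 2" for v
    using \<delta>(1) mult_pos_pos[of \<delta> "2 + 2 * real (f v)"] by (auto simp: g_def field_simps)
  have g_inj: "g v \<noteq> g w" if "v \<in> V" "w \<in> V" "v \<noteq> w" for v w
    using that \<delta>(1) inj_onD[OF f, of v w] by (auto simp: g_def field_simps)
  define l where "l v = (if 2 * \<alpha> v < S then g v - \<alpha> v else - S / 2)" for v
  \<comment> \<open>The slack \<open>\<delta> / 2\<close> exceeds every shift \<open>g v\<close>, so
    edges with weight sum exactly \<open>S\<close> survive, yet it cannot bridge a gap larger than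
    \<open>\<delta>\<close>.\<close>
  define r where "r v = (if 2 * \<alpha> v < S then g v - \<alpha> v else \<alpha> v - S + \<delta> / 2)" for v
  have lr: "l v \<le> r v" for v
    using \<delta>(1) by (auto simp: l_def r_def field_simps)
  have "{l v..r v} \<inter> {l w..r w} \<noteq> {} \<longleftrightarrow> \<alpha> v + \<alpha> w \<ge> S"
    if "v \<in> V" "w \<in> V" "v \<noteq> w" for v w
  proof -
    have "{l v..r v} \<inter> {l w..r w} \<noteq> {} \<longleftrightarrow> l v \<le> r w \<and> l w \<le> r v"
      using lr[of v] lr[of w] by auto
    also have "\<dots> \<longleftrightarrow> \<alpha> v + \<alpha> w \<ge> S"
      using gapS[of v w] gapS[of w v] gap[of v w] gap[of w v] g[of v] g[of w]
        g_inj[of v w] \<delta>(1) that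
      unfolding l_def r_def by (smt (verit) field_sum_of_halves)
    finally show ?thesis .
  qed
  then have "G = graph_of V (\<lambda>v w. {l v..r v} \<inter> {l w..r w} \<noteq> {})"
    by (subst G) (auto simp: threshold_graph_on_def V_def intro!: graph_of_cong)
  then show ?thesis
    unfolding interval_graph_def V_def[symmetric]
    using finV lr by (intro conjI exI[of _ l] exI[of _ r]) auto
qed

lemma boxicity_le_threshold_dim:
  assumes "simple_graph G"
  shows "boxicity G \<le> threshold_dim G"
proof -
  have "intersection_of interval_graph (threshold_dim G) G"
    using threshold_dim_attained[OF assms] threshold_imp_interval
    unfolding intersection_of_def by blast
  then show ?thesis unfolding boxicity_def by (rule Least_le)
qed

section \<open>Upper bound on the threshold dimension\<close>

abbreviation proper_subsets :: "nat \<Rightarrow> nat set set" where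
  "proper_subsets n \<equiv> {A. A \<subseteq> {1..n} \<and> A \<noteq> {} \<and> A \<noteq> {1..n}}"

lemma finite_proper_subsets: "finite (proper_subsets n)"
  by (rule finite_subset[of _ "Pow {1..n}"]) auto

lemma disjointness_graph_edge_iff:
  "{A, B} \<in> edges (disjointness_graph n) \<longleftrightarrow>
     A \<in> proper_subsets n \<and> B \<in> proper_subsets n \<and> A \<noteq> B \<and> A \<inter> B = {}"
  unfolding disjointness_graph_def by (subst edge_graph_of_iff) auto

text \<open>The weight is additive with total \<open>3\<close>, so two sets of total weight above \<open>3\<close> meet.
  Distinct sets that share \<open>n\<close> differ in some \<open>j < n\<close> and have total weight at least \<open>4\<close>
  for this \<open>j\<close>.\<close>

lemma threshold_dim_disjointness_graph_le:
  assumes "n \<ge> 1"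
  shows "threshold_dim (disjointness_graph n) \<le> n - 1"
proof -
  let ?V = "proper_subsets n"
  \<comment> \<open>The minus sign turns weight at most 3 into a threshold condition;
    \<open>Suc j\<close> runs through the elements below \<open>n\<close>.\<close>
  define a :: "nat \<Rightarrow> nat set \<Rightarrow> real" where
    "a j A = - ((if Suc j \<in> A then 2 else 0) + (if n \<in> A then 1 else 0))" for j A
  let ?H = "\<lambda>j. threshold_graph_on ?V (a j) (- 3)"
  have H: "{A, B} \<in> edges (?H j) \<longleftrightarrow> A \<in> ?V \<and> B \<in> ?V \<and> A \<noteq> B \<and> a j A + a j B \<ge> - 3" for A B j
    unfolding threshold_graph_on_def by (subst edge_graph_of_iff) (auto simp: add.commute)
  have disj: "a j A + a j B \<ge> - 3" if "A \<inter> B = {}" "j < n - 1" for A B j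
    using that by (auto simp: a_def)
  have meet: "\<exists>j<n-1. \<not> a j A + a j B \<ge> - 3"
    if AB: "A \<in> ?V" "B \<in> ?V" "A \<noteq> B" "A \<inter> B \<noteq> {}" for A B
  proof (cases "n \<in> A \<and> n \<in> B")
    case True
    obtain i where i: "(i \<in> A) \<noteq> (i \<in> B)" using AB by blast
    then have "i \<in> {1..n}" "i \<noteq> n" using AB True by auto
    then obtain j where "i = Suc j" "j < n - 1" by (cases i) auto
    then show ?thesis using i True by (intro exI[of _ j]) (auto simp: a_def)
  next
    case False
    \<comment> \<open>A common element other than \<open>n\<close> alone contributes weight 2 + 2 >
      3.\<close>
    obtain i where i: "i \<in> A" "i \<in> B" using AB by blast
    then have "i \<in> {1..n}" "i \<noteq> n" using AB False by auto
    then obtain j where "i = Suc j" "j < n - 1" by (cases i) auto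
    then show ?thesis using i by (intro exI[of _ j]) (auto simp: a_def)
  qed
  have "e \<in> edges (disjointness_graph n) \<longleftrightarrow>
      e \<in> all_pairs ?V \<inter> (\<Inter>j<n-1. edges (?H j))" for e
  proof (cases "e \<in> all_pairs ?V")
    case True
    then obtain A B where e: "e = {A, B}" "A \<in> ?V" "B \<in> ?V" "A \<noteq> B"
      unfolding all_pairs_def by blast
    have "e \<in> edges (disjointness_graph n) \<longleftrightarrow> A \<inter> B = {}"
      using e by (simp only: disjointness_graph_edge_iff) simp
    also have "\<dots> \<longleftrightarrow> (\<forall>j<n-1. a j A + a j B \<ge> - 3)"
      using disj meet[OF e(2-4)] by blast
    also have "\<dots> \<longleftrightarrow> (\<forall>j<n-1. e \<in> edges (?H j))"
      using e by (simp only: H) simp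
    finally show ?thesis using True by blast
  next
    case False
    then show ?thesis
      using simple_graph_disjointness_graph[of n]
      by (auto simp: simple_graph_def disjointness_graph_def)
  qed
  then have "edges (disjointness_graph n) = all_pairs ?V \<inter> (\<Inter>j<n-1. edges (?H j))"
    by blast
  moreover have "threshold_graph (?H j) \<and> verts (?H j) = ?V" for j
    unfolding threshold_graph_def using finite_proper_subsets
    by (auto simp: threshold_graph_on_def)
  moreover have "verts (disjointness_graph n) = ?V"
    by (simp add: disjointness_graph_def)
  ultimately have "intersection_of threshold_graph (n - 1) (disjointness_graph n)"
    unfolding intersection_of_def by (intro exI[of _ ?H]) simp
  then show ?thesis unfolding threshold_dim_def by (rule Least_le)
qed

section \<open>Separated pairs in a single interval graph\<close>

text \<open>Allowing \<open>k = m\<close> in \<open>meet\<close> covers singletons and two-element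
  sets alike. If \<open>r {k, m} < l {k}\<close>, then \<open>{k, m}\<close> also ends before
  \<open>{a}\<close> starts, where \<open>a\<close> maximises \<open>l {a}\<close>, so it contains
  \<open>a\<close>. Two distinct exceptions \<open>k\<close>, \<open>k'\<close> would give
  \<open>r {k, a} < l {k} \<le> r {k', a}\<close> and the same with \<open>k\<close> and
  \<open>k'\<close> exchanged.\<close>

lemma left_separated_pairs:
  fixes l r :: "'a set \<Rightarrow> real"
  assumes X: "finite X" "X \<noteq> {}"
    and meet: "\<And>k m k' m'. \<lbrakk>{k, m, k', m'} \<subseteq> X; {k, m} \<inter> {k', m'} = {}\<rbrakk> \<Longrightarrow> l {k, m} \<le> r {k', m'}"
  obtains a x where
    "\<And>k m. \<lbrakk>k \<in> X; m \<in> X; k \<noteq> m; r {k, m} < l {k}\<rbrakk> \<Longrightarrow> k = a \<or> m = a \<and> k = x"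
proof -
  have meet1: "l {p} \<le> r {k, m}" if "p \<in> X" "k \<in> X" "m \<in> X" "p \<noteq> k" "p \<noteq> m" for p k m
    using meet[of p p k m] that by auto
  obtain a where a: "a \<in> X" "\<And>k. k \<in> X \<Longrightarrow> l {k} \<le> l {a}"
  proof -
    have "Max ((\<lambda>k. l {k}) ` X) \<in> (\<lambda>k. l {k}) ` X" using X by simp
    then obtain a where "a \<in> X" "Max ((\<lambda>k. l {k}) ` X) = l {a}" by blast
    moreover have "l {k} \<le> Max ((\<lambda>k. l {k}) ` X)" if "k \<in> X" for k using X that by simp
    ultimately show ?thesis using that by simp
  qed
  have 1: "k = a \<or> m = a" if "k \<in> X" "m \<in> X" "r {k, m} < l {k}" for k m
    using meet1[of a k m] a that by fastforce
  have 2: "k = k'"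
    if "k \<in> X" "k' \<in> X" "k \<noteq> a" "k' \<noteq> a" "r {k, a} < l {k}" "r {k', a} < l {k'}" for k k'
    using meet1[of k k' a] meet1[of k' k a] a that by fastforce
  show ?thesis
  proof (cases "\<exists>x\<in>X. x \<noteq> a \<and> r {x, a} < l {x}")
    case True
    then obtain x where "x \<in> X" "x \<noteq> a" "r {x, a} < l {x}" by blast
    then show ?thesis using that[of a x] 1 2 by metis
  next
    case False
    \<comment> \<open>Without an exception, \<open>x = a\<close> serves as a default: it adds
      nothing to the alternative \<open>k = a\<close>.\<close>
    then show ?thesis using that[of a a] 1 by metis
  qed
qed

text \<open>At most \<open>card X - 1\<close> pairs leave the centre and two enter it; in the
  application one entering pair is left-separated, the other right-separated.\<close>

lemma card_star_le:
  assumes "finite X" "C \<subseteq> {a} \<times> (X - {a}) \<union> {(x, a), (y, a)}" "a \<in> X"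
  shows "card C \<le> card X + 1"
proof -
  have "card C \<le> card ({a} \<times> (X - {a}) \<union> {(x, a), (y, a)})"
    using assms by (intro card_mono) auto
  also have "\<dots> \<le> card ({a} \<times> (X - {a})) + card {(x, a), (y, a)}"
    by (rule card_Un_le)
  also have "\<dots> \<le> (card X - 1) + 2"
    using assms by (intro add_mono) (auto simp: card_cartesian_product card_insert_if)
  also have "\<dots> = card X + 1"
    using assms card_gt_0_iff[of X] by (auto simp: Suc_diff_le)
  finally show ?thesis .
qed

text \<open>Either the pairs form a star, or both kinds occur off the edge \<open>{a, b}\<close>; in the latter
  case they lie in a triangle, and not all six orientations are possible.\<close>

lemma card_cross_intersecting_pairs_le:
  assumes X: "finite X"
    and L: "\<And>k m. (k, m) \<in> L \<Longrightarrow> k \<in> X \<and> m \<in> X \<and> k \<noteq> m \<and> (k = a \<or> m = a \<and> k = x)"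
    and R: "\<And>k m. (k, m) \<in> R \<Longrightarrow> k \<in> X \<and> m \<in> X \<and> k \<noteq> m \<and> (k = b \<or> m = b \<and> k = y)"
    and LR: "\<And>k m k' m'. \<lbrakk>(k, m) \<in> L; (k', m') \<in> R\<rbrakk> \<Longrightarrow>
      {k, m} \<inter> {k', m'} \<noteq> {} \<and> {k, m} \<noteq> {k', m'}"
  shows "card (L \<union> R) \<le> max (card X + 1) 5"
proof -
  consider (empty) "L \<union> R = {}"
    | (starL) z z' where "a \<in> X" "L \<union> R \<subseteq> {a} \<times> (X - {a}) \<union> {(z, a), (z', a)}"
    | (starR) z z' where "b \<in> X" "L \<union> R \<subseteq> {b} \<times> (X - {b}) \<union> {(z, b), (z', b)}"
    | (triangle) k m k' m' where "a \<noteq> b" "(k, m) \<in> L" "b \<notin> {k, m}" "(k', m') \<in> R" "a \<notin> {k', m'}"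
  proof (cases "\<forall>(k', m') \<in> R. a \<in> {k', m'}")
    case True
    then have aR: "a = k \<or> a = m" if "(k, m) \<in> R" for k m using that by auto
    show ?thesis
    proof (cases "L \<union> R = {}")
      case False
      then have "a \<in> X" using L R True by fastforce
      \<comment> \<open>A pair of \<open>R\<close> entering \<open>a\<close> must be
        \<open>(b, a)\<close> if \<open>a \<noteq> b\<close>, and \<open>(y, a)\<close> if
        \<open>a = b\<close>.\<close>
      moreover have "L \<union> R \<subseteq> {a} \<times> (X - {a}) \<union> {(x, a), (if a = b then y else b, a)}"
      proof (rule subrelI)
        fix k m assume "(k, m) \<in> L \<union> R"
        then show "(k, m) \<in> {a} \<times> (X - {a}) \<union> {(x, a), (if a = b then y else b, a)}"
          using L[of k m] R[of k m] aR[of k m] by auto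
      qed
      ultimately show ?thesis by (rule starL)
    qed (rule empty)
  next
    case notR: False
    show ?thesis
    proof (cases "\<forall>(k, m) \<in> L. b \<in> {k, m}")
      case True
      then have bL: "b = k \<or> b = m" if "(k, m) \<in> L" for k m using that by auto
      have "b \<in> X" using R notR by fastforce
      moreover have "L \<union> R \<subseteq> {b} \<times> (X - {b}) \<union> {(y, b), (if a = b then x else a, b)}"
      proof (rule subrelI)
        fix k m assume "(k, m) \<in> L \<union> R"
        then show "(k, m) \<in> {b} \<times> (X - {b}) \<union> {(y, b), (if a = b then x else a, b)}"
          using L[of k m] R[of k m] bL[of k m] by auto
      qed
      ultimately show ?thesis by (rule starR)
    next
      case False
      then show ?thesis using notR triangle L R by fastforce
    qed
  qed
  then show ?thesis
  proof cases
    case empty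
    then show ?thesis by simp
  next
    case starL
    then show ?thesis using card_star_le[OF X starL(2,1)] by simp
  next
    case starR
    then show ?thesis using card_star_le[OF X starR(2,1)] by simp
  next
    case triangle
    \<comment> \<open>The two edges meet, but neither in \<open>a\<close> nor in \<open>b\<close>,
      so their other endpoints coincide.\<close>
    obtain c where c: "{k, m} = {a, c}" "{k', m'} = {b, c}" "c \<noteq> a" "c \<noteq> b"
    proof -
      obtain c where "{k, m} = {a, c}" "c \<noteq> a" using L[OF triangle(2)] by fastforce
      moreover have "c \<noteq> b" using calculation triangle by auto
      moreover obtain c' where "{k', m'} = {b, c'}" using R[OF triangle(4)] by fastforce
      moreover have "c' = c"
        using LR[OF triangle(2,4)] calculation triangle by auto
      ultimately show ?thesis using that by blast
    qed
    let ?T = "{(a, b), (b, a), (a, c), (c, a), (b, c), (c, b)}"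
    have subL: "(p, q) \<in> {(a, b), (b, a), (a, c), (c, a)}" if "(p, q) \<in> L" for p q
      using L[OF that] LR[OF that triangle(4)] c triangle(1) by auto
    have subR: "(p, q) \<in> {(a, b), (b, a), (b, c), (c, b)}" if "(p, q) \<in> R" for p q
      using R[OF that] LR[OF triangle(2) that] c triangle(1) by auto
    have "L \<union> R \<noteq> ?T"
    proof
      assume T: "L \<union> R = ?T"
      \<comment> \<open>Pairs in \<open>L\<close> contain \<open>a\<close> and those in
        \<open>R\<close> contain \<open>b\<close>, which forces these memberships and uses up both
        exceptions. Then \<open>(b, a)\<close> can only lie in \<open>R\<close> and
        \<open>(a, b)\<close> only in \<open>L\<close>, although they have the same underlying
        set.\<close>
      have "(c, a) \<in> L" "(c, b) \<in> R" using T subL[of c b] subR[of c a] c triangle(1) by blast+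
      then have "x = c" "y = c" using L[of c a] R[of c b] c by auto
      then have "(b, a) \<in> R" "(a, b) \<in> L" using T L[of b a] R[of a b] c triangle(1) by blast+
      then show False using LR[of a b b a] by auto
    qed
    moreover have "L \<union> R \<subseteq> ?T" using subL subR by fast
    ultimately have "L \<union> R \<subset> ?T" by (rule psubsetI[rotated])
    then have "card (L \<union> R) < card ?T" by (rule psubset_card_mono[rotated]) simp
    also have "card ?T \<le> 6"
      using card_length[of "[(a, b), (b, a), (a, c), (c, a), (b, c), (c, b)]"] by simp
    finally show ?thesis by simp
  qed
qed

text \<open>Reflecting the line, which replaces \<open>l\<close>, \<open>r\<close> by
  \<open>- r\<close>, \<open>- l\<close>, reduces right separation to left separation. As singletons
  pairwise meet, a left pair and a right pair satisfy
  \<open>r {k, m} < l {k} \<le> r {k'} < l {k', m'}\<close>; so their sets are neither disjoint nor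
  equal.\<close>

lemma card_separated_pairs_le:
  fixes l r :: "'a set \<Rightarrow> real"
  assumes X: "finite X" "X \<noteq> {}"
    and lr: "\<And>k m. \<lbrakk>k \<in> X; m \<in> X\<rbrakk> \<Longrightarrow> l {k, m} \<le> r {k, m}"
    and meet: "\<And>k m k' m'. \<lbrakk>{k, m, k', m'} \<subseteq> X; {k, m} \<inter> {k', m'} = {}\<rbrakk> \<Longrightarrow> l {k, m} \<le> r {k', m'}"
  shows "card {(k, m). k \<in> X \<and> m \<in> X \<and> k \<noteq> m \<and> (r {k, m} < l {k} \<or> r {k} < l {k, m})}
    \<le> max (card X + 1) 5"
proof -
  let ?L = "{(k, m). k \<in> X \<and> m \<in> X \<and> k \<noteq> m \<and> r {k, m} < l {k}}"
  let ?R = "{(k, m). k \<in> X \<and> m \<in> X \<and> k \<noteq> m \<and> r {k} < l {k, m}}"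
  obtain a x where L: "\<And>k m. \<lbrakk>k \<in> X; m \<in> X; k \<noteq> m; r {k, m} < l {k}\<rbrakk> \<Longrightarrow> k = a \<or> m = a \<and> k = x"
    using left_separated_pairs[OF X, of l r] meet by blast
  have "- r {k, m} \<le> - l {k', m'}" if "{k, m, k', m'} \<subseteq> X" "{k, m} \<inter> {k', m'} = {}" for k m k' m'
    using meet[of k' m' k m] that by auto
  then obtain b y where R: "\<And>k m. \<lbrakk>k \<in> X; m \<in> X; k \<noteq> m; - l {k, m} < - r {k}\<rbrakk> \<Longrightarrow> k = b \<or> m = b \<and> k = y"
    using left_separated_pairs[OF X, of "\<lambda>A. - r A" "\<lambda>A. - l A"] by blast
  have LR: "{k, m} \<inter> {k', m'} \<noteq> {} \<and> {k, m} \<noteq> {k', m'}"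
    if "(k, m) \<in> ?L" "(k', m') \<in> ?R" for k m k' m'
  proof -
    have X4: "k \<in> X" "m \<in> X" "k' \<in> X" "m' \<in> X" "k \<noteq> m" "k' \<noteq> m'" using that by auto
    have "l {k} \<le> r {k'}"
      using meet[of k k k' k'] lr[of k k] X4 by (cases "k = k'") auto
    then have "r {k, m} < l {k', m'}" using that by auto
    then show ?thesis
      using meet[of k' m' k m] lr[of k m] X4 by (auto simp: Int_commute)
  qed
  have "card (?L \<union> ?R) \<le> max (card X + 1) 5"
    by (rule card_cross_intersecting_pairs_le[OF X(1), of _ a x _ b y])
      (use L R LR in auto)
  also have "?L \<union> ?R = {(k, m). k \<in> X \<and> m \<in> X \<and> k \<noteq> m \<and> (r {k, m} < l {k} \<or> r {k} < l {k, m})}"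
    by auto
  finally show ?thesis .
qed

section \<open>Lower bound on the boxicity\<close>

lemma boxicity_disjointness_graph_ge:
  assumes n: "n \<ge> 3"
  shows "n - 1 \<le> boxicity (disjointness_graph n)"
proof -
  let ?G = "disjointness_graph n" and ?V = "proper_subsets n" and ?X = "{1..n}"
  define d where "d = boxicity ?G"
  have vG: "verts ?G = ?V" by (simp add: disjointness_graph_def)
  obtain H where H: "\<And>j. j < d \<Longrightarrow> interval_graph (H j) \<and> verts (H j) = ?V"
    and eG: "edges ?G = all_pairs ?V \<inter> (\<Inter>j<d. edges (H j))"
    using boxicity_attained[OF simple_graph_disjointness_graph[of n]]
    unfolding intersection_of_def vG d_def[symmetric] by (elim exE conjE) (rule that; simp)
  define represents where "represents j l r \<longleftrightarrow> (\<forall>A\<in>?V. l A \<le> r A) \<and>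
      (\<forall>A\<in>?V. \<forall>B\<in>?V. A \<noteq> B \<longrightarrow> ({A, B} \<in> edges (H j) \<longleftrightarrow> l A \<le> r B \<and> l B \<le> r A))"
    for j and l r :: "nat set \<Rightarrow> real"
  have "\<exists>l r. represents j l r" if j: "j < d" for j
  proof -
    have iH: "interval_graph (H j)" and vH: "verts (H j) = ?V" using H[OF j] by auto
    obtain l r :: "nat set \<Rightarrow> real" where lr: "\<forall>A\<in>?V. l A \<le> r A"
      and Hj: "H j = graph_of ?V (\<lambda>v w. {l v..r v} \<inter> {l w..r w} \<noteq> {})"
      using iH unfolding interval_graph_def vH by blast
    have "{A, B} \<in> edges (H j) \<longleftrightarrow> l A \<le> r B \<and> l B \<le> r A" if "A \<in> ?V" "B \<in> ?V" "A \<noteq> B" for A B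
    proof -
      have "{A, B} \<in> edges (H j) \<longleftrightarrow> {l A..r A} \<inter> {l B..r B} \<noteq> {}"
        unfolding Hj using that by (subst edge_graph_of_iff) auto
      also have "\<dots> \<longleftrightarrow> l A \<le> r B \<and> l B \<le> r A"
        using bspec[OF lr that(1)] bspec[OF lr that(2)] by auto
      finally show ?thesis .
    qed
    then show ?thesis using lr unfolding represents_def by blast
  qed
  then obtain l r where "\<And>j. j < d \<Longrightarrow> represents j (l j) (r j)" by metis
  then have lr: "\<And>j A. \<lbrakk>j < d; A \<in> ?V\<rbrakk> \<Longrightarrow> l j A \<le> r j A"
    and e: "\<And>j A B. \<lbrakk>j < d; A \<in> ?V; B \<in> ?V; A \<noteq> B\<rbrakk> \<Longrightarrow>
      {A, B} \<in> edges (H j) \<longleftrightarrow> l j A \<le> r j B \<and> l j B \<le> r j A"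
    unfolding represents_def by blast+
  have pair: "{k, m} \<in> ?V" if "k \<in> ?X" "m \<in> ?X" for k m
  proof -
    \<comment> \<open>Here \<open>n \<ge> 3\<close> ensures that two elements never exhaust the
      ground set.\<close>
    have "card {k, m} < card ?X" using n by (auto simp: card_insert_if)
    then show ?thesis using that by auto
  qed
  define C where "C j = {(k, m). k \<in> ?X \<and> m \<in> ?X \<and> k \<noteq> m \<and>
    (r j {k, m} < l j {k} \<or> r j {k} < l j {k, m})}" for j
  have C: "card (C j) \<le> max (n + 1) 5" if j: "j < d" for j
  proof -
    have "l j {k, m} \<le> r j {k', m'}"
      if "{k, m, k', m'} \<subseteq> ?X" "{k, m} \<inter> {k', m'} = {}" for k m k' m'
    proof -
      have V: "{k, m} \<in> ?V" "{k', m'} \<in> ?V" using that by (intro pair; simp)+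
      then have "{{k, m}, {k', m'}} \<in> edges ?G"
        using that by (simp only: disjointness_graph_edge_iff) auto
      then have "{{k, m}, {k', m'}} \<in> edges (H j)" using eG j by blast
      then show ?thesis using e[OF j V] that by auto
    qed
    then show ?thesis
      using card_separated_pairs_le[of ?X "l j" "r j"] lr[OF j pair] n unfolding C_def by simp
  qed
  let ?P = "?X \<times> ?X - (\<lambda>k. (k, k)) ` ?X"
  have "?P \<subseteq> (\<Union>j<d. C j)"
  proof (clarify)
    fix k m assume km: "k \<in> ?X" "m \<in> ?X" "(k, m) \<notin> (\<lambda>k. (k, k)) ` ?X"
    then have ne: "k \<noteq> m" by blast
    have V: "{k} \<in> ?V" "{k, m} \<in> ?V" using pair[of k k] pair[of k m] km by auto
    have dist: "{k} \<noteq> {k, m}" using ne by auto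
    have "{{k}, {k, m}} \<notin> edges ?G" by (simp only: disjointness_graph_edge_iff) auto
    moreover have "{{k}, {k, m}} \<in> all_pairs ?V"
      unfolding all_pairs_def using V dist by blast
    ultimately obtain j where j: "j < d" "{{k}, {k, m}} \<notin> edges (H j)"
      using eG by blast
    then have "(k, m) \<in> C j" using e[OF j(1) V dist] km ne by (auto simp: C_def)
    then show "(k, m) \<in> (\<Union>j<d. C j)" using j by blast
  qed
  moreover have "finite (C j)" for j
    by (rule finite_subset[of _ "?X \<times> ?X"]) (auto simp: C_def)
  ultimately have "card ?P \<le> card (\<Union>j<d. C j)" by (intro card_mono) auto
  also have "\<dots> \<le> (\<Sum>j<d. card (C j))" by (rule card_UN_le) simp
  also have "\<dots> \<le> d * max (n + 1) 5" 
    using sum_bounded_above[of "{..<d}" "\<lambda>j. card (C j)" "max (n + 1) 5"] C by simp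
  finally have le: "card ?P \<le> d * max (n + 1) 5" .
  have "card ?P = card (?X \<times> ?X) - card ((\<lambda>k. (k, k)) ` ?X)" by (intro card_Diff_subset) auto
  also have "\<dots> = n * n - n" by (simp add: card_image inj_on_def)
  finally have P: "card ?P = n * n - n" .
  show ?thesis
  proof (rule ccontr)
    assume "\<not> n - 1 \<le> boxicity ?G"
    then have "d \<le> n - 2" by (simp add: d_def)
    then have *: "n * n - n \<le> (n - 2) * max (n + 1) 5"
      using le unfolding P by (rule le_trans[OF _ mult_le_mono1, rotated])
    \<comment> \<open>For \<open>n = 3\<close> the inequality reads 6 \<le> 5; for larger
      \<open>n\<close> the maximum is \<open>n + 1\<close>, and \<open>(n - 2) * (n + 1)\<close> is
      2 less than \<open>n * n - n\<close>.\<close>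
    obtain q where "n = q + 3" using le_Suc_ex[OF n] by (auto simp: add.commute)
    then show False using * by (cases "q = 0") (auto simp: algebra_simps max_def split: if_splits)
  qed
qed

section \<open>Small cases and conclusion\<close>

text \<open>All vertices are singletons here, so distinct ones are disjoint and the graph is
  complete.\<close>

lemma intersection_of_0_disjointness_graph:
  assumes "n \<le> 2"
  shows "intersection_of P 0 (disjointness_graph n)"
proof -
  have single: "\<exists>x. A = {x}" if "A \<in> proper_subsets n" for A
  proof -
    have "A \<subset> {1..n}" "A \<noteq> {}" using that by auto
    then have "card A < card {1..n}" by (intro psubset_card_mono) auto
    moreover have "card A \<noteq> 0"
      using \<open>A \<subset> {1..n}\<close> \<open>A \<noteq> {}\<close> finite_subset[of A "{1..n}"] by auto
    ultimately have "card A = 1" using assms by simp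
    then show ?thesis by (rule card_1_singletonE) blast
  qed
  have "A \<inter> B = {}" if "A \<in> proper_subsets n" "B \<in> proper_subsets n" "A \<noteq> B" for A B
    using single[OF that(1)] single[OF that(2)] that(3) by auto
  then have "disjointness_graph n = graph_of (proper_subsets n) (\<lambda>A B. True)"
    unfolding disjointness_graph_def by (intro graph_of_cong) simp
  then show ?thesis
    by (simp add: intersection_of_def graph_of_def all_pairs_def)
qed

theorem theorem10:
  fixes n :: nat
  assumes "n \<ge> 1"
  shows "(n \<in> {1, 2} \<longrightarrow>
           boxicity (disjointness_graph n) = 0 \<and> threshold_dim (disjointness_graph n) = 0) \<and>
         (n \<ge> 3 \<longrightarrow>
           boxicity (disjointness_graph n) = n - 1 \<and> threshold_dim (disjointness_graph n) = n - 1)"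
proof (intro conjI impI)
  assume "n \<in> {1, 2}"
  then have "intersection_of P 0 (disjointness_graph n)" for P
    by (intro intersection_of_0_disjointness_graph) auto
  then show "boxicity (disjointness_graph n) = 0" "threshold_dim (disjointness_graph n) = 0"
    unfolding boxicity_def threshold_dim_def by simp_all
next
  assume "n \<ge> 3"
  then have "n - 1 \<le> boxicity (disjointness_graph n)"
    by (rule boxicity_disjointness_graph_ge)
  moreover have "boxicity (disjointness_graph n) \<le> threshold_dim (disjointness_graph n)"
    by (intro boxicity_le_threshold_dim simple_graph_disjointness_graph)
  moreover have "threshold_dim (disjointness_graph n) \<le> n - 1"
    using assms by (rule threshold_dim_disjointness_graph_le)
  ultimately show "boxicity (disjointness_graph n) = n - 1"
    "threshold_dim (disjointness_graph n) = n - 1" by simp_all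
qed

end
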